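(* Let $\mathbf{a}=(a_1,a_2,\dots)\in \ell_2$ be a sequence of positive reals such that for every $i$ the number $\frac{1}{a_i}$ is an odd integer strictly greater than one, and suppose that $$\lim_{n\to\infty}\frac{a_1\cdots a_{n-1}}{a_n}=0.$$ Let $S=S_{\mathbf{a}}\subset[0,1]^2$ be the generalized Sierpinski carpet associated with $\mathbf{a}$. Let $\operatorname{curl}:\operatorname{Dom}(\operatorname{curl})\to L^2(S)$ be the curl operator on $S$, with domain $\operatorname{Dom}(\operatorname{curl})\subset L^2(S,\mathbb{R}^2)$. If $\operatorname{Dom}(\operatorname{curl})$ contains all smooth vector fields, then the domain $\operatorname{Dom}(\operatorname{curl}^* )\subset L^2(S)$ of the adjoint operator $\operatorname{curl}^*$ is trivial, that is, $\operatorname{Dom}(\operatorname{curl}^* )=\{0\}$.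
   Context: Generalized Sierpinski carpet. Let $\mathbf{a}=(a_1,a_2,\dots)$ be a sequence of positive reals such that each $\frac1{a_i}$ is an odd integer strictly greater than one. Put $S_{\mathbf{a},0}=[0,1]^2$ and $\mathcal{T}_0=\{[0,1]^2\}$. Given the family $\mathcal{T}_{m-1}$ of closed squares of side length $a_1\cdots a_{m-1}$ (side length $1$ if $m=1$), subdivide each of its elements into $(1/a_m)^2$ congruent closed subsquares of side length $a_1\cdots a_m$ that touch only at their boundaries, and discard the central subsquare of each; $\mathcal{T}_m$ is the family of all remaining subsquares, and $S_{\mathbf{a},m}=\bigcup_{T\in\mathcal{T}_m}T$. The generalized Sierpinski carpet associated with $\mathbf{a}$ is $S_{\mathbf{a}}=\bigcap_{m\ge 0}S_{\mathbf{a},m}$. If $\mathbf{a}\in\ell_2$, every nonempty relatively open subset of $S_{\mathbf{a}}$ has positive two-dimensional Lebesgue measure. Function spaces. $L^2(S)=L^2(S,\mathbb{R})$ and $L^2(S,\mathbb{R}^2)$ are the Hilbert spaces of (classes of) real-valued, respectively $\mathbb{R}^2$-valued, functions on $S$ that are square integrable with respect to two-dimensional Lebesgue measure restricted to $S$. Curl. For a smooth vector field $u=(u_1,u_2):\mathbb{R}^2\to\mathbb{R}^2$ one sets $\operatorname{curl}u=\frac{\partial u_2}{\partial x}-\frac{\partial u_1}{\partial y}$. Smooth vector fields are regarded as elements of $L^2(S,\mathbb{R}^2)$ by restriction to $S$, and $\operatorname{curl}u$ as an element of $L^2(S)$ by pointwise restriction to $S$. The curl operator on $S$ is a densely defined unbounded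 linear operator from $L^2(S,\mathbb{R}^2)$ to $L^2(S)$ with domain $\operatorname{Dom}(\operatorname{curl})$, acting on (restrictions of) smooth vector fields in this way. Its adjoint $\operatorname{curl}^*$ is the usual Hilbert space adjoint: $u\in\operatorname{Dom}(\operatorname{curl}^* )$ if and only if there is $w\in L^2(S,\mathbb{R}^2)$ with $\langle w,v\rangle_{L^2(S,\mathbb{R}^2)}=\langle u,\operatorname{curl}v\rangle_{L^2(S)}$ for all $v\in\operatorname{Dom}(\operatorname{curl})$. *)

theory Defs
  imports "HOL-Analysis.Analysis"
begin

section \<open>Generalized Sierpinski carpets\<close>

text \<open>The sequence is indexed from 1; the value \<open>a 0\<close> is never used. In step \<open>Suc m\<close> the
  subsquares of a square of side \<open>s\<close> are indexed by \<open>0 \<le> i, j < 1 / a (Suc m)\<close>; since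
  \<open>1 / a (Suc m)\<close> is odd, the central one has \<open>i = j\<close> with \<open>2 * i + 1 = 1 / a (Suc m)\<close>.\<close>

primrec carpet_squares :: "(nat \<Rightarrow> real) \<Rightarrow> nat \<Rightarrow> (real \<times> real) set set" where
  "carpet_squares a 0 = {cbox (0, 0) (1, 1)}"
| "carpet_squares a (Suc m) =
    (let s = (\<Prod>k=1..m. a k); r = (\<Prod>k=1..Suc m. a k) in
      {cbox (x + real i * r, y + real j * r) (x + real (i + 1) * r, y + real (j + 1) * r) | x y i j.
         cbox (x, y) (x + s, y + s) \<in> carpet_squares a m \<and>
         real i < 1 / a (Suc m) \<and> real j < 1 / a (Suc m) \<and>
         \<not> (real (2 * i + 1) = 1 / a (Suc m) \<and> real (2 * j + 1) = 1 / a (Suc m))})"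

definition carpet :: "(nat \<Rightarrow> real) \<Rightarrow> (real \<times> real) set" where
  "carpet a = (\<Inter>m. \<Union> (carpet_squares a m))"


section \<open>Spaces of classes of square integrable functions\<close>

definition square_integrable :: "'a measure \<Rightarrow> ('a \<Rightarrow> 'b::euclidean_space) set" where
  "square_integrable M = {f \<in> borel_measurable M. integrable M (\<lambda>x. (norm (f x))\<^sup>2)}"

definition ae_eq_rel :: "'a measure \<Rightarrow> (('a \<Rightarrow> 'b::euclidean_space) \<times> ('a \<Rightarrow> 'b)) set" where
  "ae_eq_rel M =
    {(f, g). f \<in> square_integrable M \<and> g \<in> square_integrable M \<and> (AE x in M. f x = g x)}"

definition L2 :: "'a measure \<Rightarrow> ('a \<Rightarrow> 'b::euclidean_space) set set" where
  "L2 M = square_integrable M // ae_eq_rel M"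

definition L2_class :: "'a measure \<Rightarrow> ('a \<Rightarrow> 'b::euclidean_space) \<Rightarrow> ('a \<Rightarrow> 'b) set" where
  "L2_class M f = ae_eq_rel M `` {f}"

definition L2_rep :: "('a \<Rightarrow> 'b) set \<Rightarrow> 'a \<Rightarrow> 'b" where
  "L2_rep X = (SOME f. f \<in> X)"

text \<open>The operations are defined through representatives; the lemmas below show that they do not
  depend on the choice.\<close>

definition L2_add :: "'a measure \<Rightarrow> ('a \<Rightarrow> 'b::euclidean_space) set \<Rightarrow> ('a \<Rightarrow> 'b) set \<Rightarrow> ('a \<Rightarrow> 'b) set" where
  "L2_add M X Y = L2_class M (\<lambda>x. L2_rep X x + L2_rep Y x)"

definition L2_scale :: "'a measure \<Rightarrow> real \<Rightarrow> ('a \<Rightarrow> 'b::euclidean_space) set \<Rightarrow> ('a \<Rightarrow> 'b) set" where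
  "L2_scale M c X = L2_class M (\<lambda>x. c *\<^sub>R L2_rep X x)"

definition L2_inner :: "'a measure \<Rightarrow> ('a \<Rightarrow> 'b::euclidean_space) set \<Rightarrow> ('a \<Rightarrow> 'b) set \<Rightarrow> real" where
  "L2_inner M X Y = (\<integral>x. L2_rep X x \<bullet> L2_rep Y x \<partial>M)"

definition L2_zero :: "'a measure \<Rightarrow> ('a \<Rightarrow> 'b::euclidean_space) set" where
  "L2_zero M = L2_class M (\<lambda>_. 0)"

definition L2_dist :: "'a measure \<Rightarrow> ('a \<Rightarrow> 'b::euclidean_space) set \<Rightarrow> ('a \<Rightarrow> 'b) set \<Rightarrow> real" where
  "L2_dist M X Y =
    (let Z = L2_add M X (L2_scale M (-1) Y) in sqrt (L2_inner M Z Z))"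

lemma equiv_ae_eq_rel: "equiv (square_integrable M) (ae_eq_rel M)"
proof (rule equivI)
  show "ae_eq_rel M \<subseteq> square_integrable M \<times> square_integrable M"
    by (auto simp: ae_eq_rel_def)
  show "refl_on (square_integrable M) (ae_eq_rel M)"
    by (auto simp: refl_on_def ae_eq_rel_def)
  show "sym (ae_eq_rel M)"
    by (auto simp: sym_def ae_eq_rel_def elim!: AE_mp)
  show "trans (ae_eq_rel M)"
  proof (rule transI)
    fix f g h assume "(f, g) \<in> ae_eq_rel M" "(g, h) \<in> ae_eq_rel M"
    then have fh: "f \<in> square_integrable M" "h \<in> square_integrable M"
      and 1: "AE x in M. f x = g x" and 2: "AE x in M. g x = h x"
      by (auto simp: ae_eq_rel_def)
    from 1 2 have "AE x in M. f x = h x" by eventually_elim simp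
    with fh show "(f, h) \<in> ae_eq_rel M" by (simp add: ae_eq_rel_def)
  qed
qed

lemma L2_class_in_L2: "f \<in> square_integrable M \<Longrightarrow> L2_class M f \<in> L2 M"
  unfolding L2_def L2_class_def by (rule quotientI)

lemma L2_class_eq_iff:
  assumes "f \<in> square_integrable M" "g \<in> square_integrable M"
  shows "L2_class M f = L2_class M g \<longleftrightarrow> (AE x in M. f x = g x)"
  using eq_equiv_class_iff[OF equiv_ae_eq_rel assms] assms
  by (simp add: L2_class_def ae_eq_rel_def)

lemma L2_rep_class:
  assumes "f \<in> square_integrable M"
  shows "L2_rep (L2_class M f) \<in> square_integrable M"
    and "AE x in M. L2_rep (L2_class M f) x = f x"
proof -
  have "f \<in> L2_class M f"
    using assms by (simp add: L2_class_def ae_eq_rel_def)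
  then have "L2_rep (L2_class M f) \<in> L2_class M f"
    unfolding L2_rep_def by (rule someI[where P = "\<lambda>h. h \<in> L2_class M f"])
  then have *: "L2_rep (L2_class M f) \<in> square_integrable M"
    "AE x in M. f x = L2_rep (L2_class M f) x"
    by (auto simp: L2_class_def ae_eq_rel_def)
  show "L2_rep (L2_class M f) \<in> square_integrable M" by (fact *(1))
  show "AE x in M. L2_rep (L2_class M f) x = f x"
    using *(2) by eventually_elim simp
qed

lemma square_integrable_add:
  assumes "f \<in> square_integrable M" "g \<in> square_integrable M"
  shows "(\<lambda>x. f x + g x) \<in> square_integrable M"
proof -
  have [measurable]: "f \<in> borel_measurable M" "g \<in> borel_measurable M"
    and int: "integrable M (\<lambda>x. (norm (f x))\<^sup>2)" "integrable M (\<lambda>x. (norm (g x))\<^sup>2)"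
    using assms by (auto simp: square_integrable_def)
  have "integrable M (\<lambda>x. (norm (f x + g x))\<^sup>2)"
  proof (rule Bochner_Integration.integrable_bound)
    show "integrable M (\<lambda>x. 2 * (norm (f x))\<^sup>2 + 2 * (norm (g x))\<^sup>2)"
      using int by simp
    have "(norm (f x + g x))\<^sup>2 \<le> 2 * (norm (f x))\<^sup>2 + 2 * (norm (g x))\<^sup>2" for x
    proof -
      have "(norm (f x + g x))\<^sup>2 \<le> (norm (f x) + norm (g x))\<^sup>2"
        by (intro power_mono norm_triangle_ineq) simp
      also have "\<dots> \<le> 2 * (norm (f x))\<^sup>2 + 2 * (norm (g x))\<^sup>2"
        using sum_squares_bound[of "norm (f x)" "norm (g x)"] by (simp add: power2_sum)
      finally show ?thesis .
    qed
    then show "AE x in M. norm ((norm (f x + g x))\<^sup>2)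
        \<le> norm (2 * (norm (f x))\<^sup>2 + 2 * (norm (g x))\<^sup>2)"
      by simp
  qed measurable
  then show ?thesis by (simp add: square_integrable_def)
qed

lemma square_integrable_scale:
  assumes "f \<in> square_integrable M"
  shows "(\<lambda>x. c *\<^sub>R f x) \<in> square_integrable M"
  using assms by (auto simp: square_integrable_def power_mult_distrib)

lemma L2_add_class:
  assumes f: "f \<in> square_integrable M" and g: "g \<in> square_integrable M"
  shows "L2_add M (L2_class M f) (L2_class M g) = L2_class M (\<lambda>x. f x + g x)"
  unfolding L2_add_def
proof (subst L2_class_eq_iff)
  show "AE x in M. L2_rep (L2_class M f) x + L2_rep (L2_class M g) x = f x + g x"
    using L2_rep_class(2)[OF f] L2_rep_class(2)[OF g] by eventually_elim simp
qed (intro square_integrable_add L2_rep_class f g TrueI)+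

lemma L2_scale_class:
  assumes f: "f \<in> square_integrable M"
  shows "L2_scale M c (L2_class M f) = L2_class M (\<lambda>x. c *\<^sub>R f x)"
  unfolding L2_scale_def
proof (subst L2_class_eq_iff)
  show "AE x in M. c *\<^sub>R L2_rep (L2_class M f) x = c *\<^sub>R f x"
    using L2_rep_class(2)[OF f] by eventually_elim simp
qed (intro square_integrable_scale L2_rep_class f TrueI)+

lemma L2_inner_class:
  assumes f: "f \<in> square_integrable M" and g: "g \<in> square_integrable M"
  shows "L2_inner M (L2_class M f) (L2_class M g) = (\<integral>x. f x \<bullet> g x \<partial>M)"
  unfolding L2_inner_def
proof (rule integral_cong_AE)
  show "AE x in M. L2_rep (L2_class M f) x \<bullet> L2_rep (L2_class M g) x = f x \<bullet> g x"
    using L2_rep_class(2)[OF f] L2_rep_class(2)[OF g] by eventually_elim simp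
qed (use L2_rep_class(1)[OF f] L2_rep_class(1)[OF g] f g in
  \<open>auto simp: square_integrable_def intro: borel_measurable_inner\<close>)


section \<open>Unbounded operators and their adjoints\<close>

text \<open>An operator is given by its domain \<open>D\<close> and a function \<open>T\<close> whose values outside \<open>D\<close> are
  irrelevant.\<close>

definition densely_defined_operator ::
    "'a measure \<Rightarrow> ('a \<Rightarrow> 'b::euclidean_space) set set \<Rightarrow>
      (('a \<Rightarrow> 'b) set \<Rightarrow> ('a \<Rightarrow> 'c::euclidean_space) set) \<Rightarrow> bool" where
  "densely_defined_operator M D T \<longleftrightarrow>
    D \<subseteq> L2 M \<and> L2_zero M \<in> D \<and>
    (\<forall>X\<in>D. \<forall>Y\<in>D. L2_add M X Y \<in> D) \<and> (\<forall>c. \<forall>X\<in>D. L2_scale M c X \<in> D) \<and>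
    (\<forall>X\<in>L2 M. \<forall>e>0. \<exists>Y\<in>D. L2_dist M X Y < e) \<and>
    (\<forall>X\<in>D. T X \<in> L2 M) \<and>
    (\<forall>X\<in>D. \<forall>Y\<in>D. T (L2_add M X Y) = L2_add M (T X) (T Y)) \<and>
    (\<forall>c. \<forall>X\<in>D. T (L2_scale M c X) = L2_scale M c (T X))"

definition adjoint_domain ::
    "'a measure \<Rightarrow> ('a \<Rightarrow> 'b::euclidean_space) set set \<Rightarrow>
      (('a \<Rightarrow> 'b) set \<Rightarrow> ('a \<Rightarrow> 'c::euclidean_space) set) \<Rightarrow> ('a \<Rightarrow> 'c) set set" where
  "adjoint_domain M D T =
    {U \<in> L2 M. \<exists>W \<in> L2 M. \<forall>V\<in>D. L2_inner M W V = L2_inner M U (T V)}"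


section \<open>The curl operator\<close>

primrec C_k :: "nat \<Rightarrow> ('a::euclidean_space \<Rightarrow> 'b::euclidean_space) \<Rightarrow> bool" where
  "C_k 0 f \<longleftrightarrow> continuous_on UNIV f"
| "C_k (Suc k) f \<longleftrightarrow>
    (\<forall>x. f differentiable (at x)) \<and> (\<forall>v. C_k k (\<lambda>x. frechet_derivative f (at x) v))"

definition C_infinity :: "('a::euclidean_space \<Rightarrow> 'b::euclidean_space) \<Rightarrow> bool" where
  "C_infinity f \<longleftrightarrow> (\<forall>k. C_k k f)"

definition curl :: "(real \<times> real \<Rightarrow> real \<times> real) \<Rightarrow> real \<times> real \<Rightarrow> real" where
  "curl u = (\<lambda>(x, y). deriv (\<lambda>t. snd (u (t, y))) x - deriv (\<lambda>t. fst (u (x, t))) y)"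

text \<open>The domain of a curl operator is not fixed: the definition only prescribes the action on
  those smooth fields whose class lies in the domain.\<close>

definition is_curl_operator ::
    "(real \<times> real) set \<Rightarrow> (real \<times> real \<Rightarrow> real \<times> real) set set \<Rightarrow>
      ((real \<times> real \<Rightarrow> real \<times> real) set \<Rightarrow> (real \<times> real \<Rightarrow> real) set) \<Rightarrow> bool" where
  "is_curl_operator S D T \<longleftrightarrow>
    densely_defined_operator (lebesgue_on S) D T \<and>
    (\<forall>u. C_infinity u \<and> L2_class (lebesgue_on S) u \<in> D \<longrightarrow>
      T (L2_class (lebesgue_on S) u) = L2_class (lebesgue_on S) (curl u))"

end

theory Submission
  imports Defs
begin

text \<open>
  The curl operator on the carpet is as far from closable as possible: there are polynomial fields
  that tend to \<open>0\<close> uniformly on the carpet while their curls tend uniformly to \<open>1\<close>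
  (\<open>carpet_small_fields\<close>). Multiplying such fields \<open>v\<close> by a polynomial \<open>p\<close> gives fields that
  still tend to \<open>0\<close>, and the product rule
  \<open>curl (p v) = p curl v + (D\<^sub>1 p) v\<^sub>2 - (D\<^sub>2 p) v\<^sub>1\<close>, where \<open>D\<^sub>1\<close> and \<open>D\<^sub>2\<close> are the partial derivatives,
  shows that their curls tend to \<open>p\<close>. If \<open>u\<close> lies in the domain of the adjoint, with image \<open>w\<close>,
  then the inner product of \<open>u\<close> with \<open>curl (p v)\<close> is that of \<open>w\<close> with \<open>p v\<close>, which tends to
  \<open>0\<close>. So \<open>u\<close> is orthogonal to every polynomial and hence vanishes almost everywhere
  (\<open>AE_zero_if_orthogonal_to_polynomials\<close>, \<open>adjoint_domain_trivial_if_small_fields\<close>).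

  The small fields exploit the holes, inside which the curl is unconstrained and may compensate a
  curl of \<open>1\<close> outside. Write \<open>s = a\<^sub>1 \<cdots> a\<^sub>m\<close> and \<open>b = a\<^bsub>m+1\<^esub>\<close>; each square of the grid
  of mesh \<open>s\<close> that meets the carpet in its interior has a central hole of side \<open>s b\<close>. Let \<open>h\<close> be a
  nonnegative continuous function of one variable that is supported within distance \<open>s b / 2\<close> of
  the midpoints of the intervals of that mesh and has mean value \<open>1\<close> on each of them, and let
  \<open>G' = 1 - h\<close>, \<open>G 0 = 0\<close>. The field \<open>(- h x * G y, G x)\<close> has curl \<open>1 - h x * h y\<close>. This is \<open>1\<close>
  off the holes, since \<open>h x\<close> and \<open>h y\<close> are both nonzero only where a column of holes crosses a row
  of holes. Moreover \<open>G\<close> is bounded by \<open>s\<close> and \<open>h\<close> by \<open>2 / b\<close>, so the field is of size \<open>s / b\<close>,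
  which is the quantity that is assumed to tend to \<open>0\<close>.

  Approximating \<open>h\<close> uniformly by a polynomial, and integrating that polynomial to approximate \<open>G\<close>,
  turns this into a polynomial field with errors as small as desired (\<open>polynomial_profile\<close>).
\<close>

section \<open>Polynomial vector fields\<close>

lemma real_polynomial_function_has_derivative:
  fixes p :: "'a::euclidean_space \<Rightarrow> real"
  assumes "real_polynomial_function p"
  shows "\<exists>D. (\<forall>x. (p has_derivative D x) (at x)) \<and> (\<forall>v. real_polynomial_function (\<lambda>x. D x v))"
  using assms
proof induction
  case (linear f)
  then show ?case
    by (intro exI[of _ "\<lambda>_. f"]) (auto simp: bounded_linear_imp_has_derivative)
next
  case (const c)
  show ?case
    by (intro exI[of _ "\<lambda>_ _. 0"]) auto
next
  case (add f g)
  then obtain D E where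
    "\<forall>x. (f has_derivative D x) (at x)" "\<forall>v. real_polynomial_function (\<lambda>x. D x v)"
    "\<forall>x. (g has_derivative E x) (at x)" "\<forall>v. real_polynomial_function (\<lambda>x. E x v)"
    by blast
  then show ?case
    by (intro exI[of _ "\<lambda>x v. D x v + E x v"]) (auto intro: has_derivative_add)
next
  case (mult f g)
  then obtain D E where
    "\<forall>x. (f has_derivative D x) (at x)" "\<forall>v. real_polynomial_function (\<lambda>x. D x v)"
    "\<forall>x. (g has_derivative E x) (at x)" "\<forall>v. real_polynomial_function (\<lambda>x. E x v)"
    by blast
  with mult.hyps show ?case
    by (intro exI[of _ "\<lambda>x v. f x * E x v + D x v * g x"])
      (auto intro!: has_derivative_mult real_polynomial_function.intros(3) real_polynomial_function.intros(4))
qed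

lemma polynomial_function_frechet_derivative:
  fixes p :: "'a::euclidean_space \<Rightarrow> 'b::euclidean_space"
  assumes "polynomial_function p"
  shows "polynomial_function (\<lambda>x. frechet_derivative p (at x) v)"
  unfolding polynomial_function_iff_Basis_inner
proof
  fix b :: 'b assume "b \<in> Basis"
  then have "real_polynomial_function (\<lambda>x. p x \<bullet> b)"
    using assms by (simp add: polynomial_function_iff_Basis_inner)
  then obtain D where D: "\<And>x. ((\<lambda>x. p x \<bullet> b) has_derivative D x) (at x)"
      "\<And>v. real_polynomial_function (\<lambda>x. D x v)"
    using real_polynomial_function_has_derivative by blast
  have "frechet_derivative p (at x) v \<bullet> b = D x v" for x
  proof -
    have "(p has_derivative frechet_derivative p (at x)) (at x)"
      using differentiable_at_polynomial_function[OF assms] frechet_derivative_works by blast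
    then have "((\<lambda>x. p x \<bullet> b) has_derivative (\<lambda>v. frechet_derivative p (at x) v \<bullet> b)) (at x)"
      by (rule has_derivative_inner_left)
    from has_derivative_unique[OF this D(1)] show ?thesis
      by (rule fun_cong)
  qed
  then show "real_polynomial_function (\<lambda>x. frechet_derivative p (at x) v \<bullet> b)"
    using D(2) by simp
qed

lemma C_infinity_polynomial_function:
  fixes p :: "'a::euclidean_space \<Rightarrow> 'b::euclidean_space"
  assumes "polynomial_function p"
  shows "C_infinity p"
proof -
  have "C_k k p" for k
    using assms
  proof (induction k arbitrary: p)
    case 0
    then show ?case by (simp add: continuous_on_polymonial_function)
  next
    case (Suc k)
    then show ?case
      by (simp add: differentiable_at_polynomial_function polynomial_function_frechet_derivative)
  qed
  then show ?thesis by (simp add: C_infinity_def)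
qed

lemma polynomial_function_Pair:
  fixes f g :: "real \<times> real \<Rightarrow> real"
  assumes "real_polynomial_function f" "real_polynomial_function g"
  shows "polynomial_function (\<lambda>z. (f z, g z))"
  using assms by (auto simp: polynomial_function_iff_Basis_inner Basis_prod_def)

lemma polynomial_function_scaleR:
  fixes f :: "'a::euclidean_space \<Rightarrow> real" and v :: "'a \<Rightarrow> 'b::euclidean_space"
  assumes "real_polynomial_function f" "polynomial_function v"
  shows "polynomial_function (\<lambda>x. f x *\<^sub>R v x)"
  using assms by (auto simp: polynomial_function_iff_Basis_inner)

lemma real_polynomial_function_antiderivative:
  fixes p :: "real \<Rightarrow> real"
  assumes "real_polynomial_function p"
  obtains P where "real_polynomial_function P" "P 0 = 0"
    "\<And>x. (P has_field_derivative p x) (at x)"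
proof -
  from assms obtain c n where p: "p = (\<lambda>x. \<Sum>i\<le>n. c i * x ^ i)"
    by (auto simp: real_polynomial_function_iff_sum)
  define P where "P = (\<lambda>x. \<Sum>i\<le>n. (c i / real (Suc i)) * x ^ Suc i)"
  have "real_polynomial_function P"
    unfolding P_def
    by (intro real_polynomial_function_sum finite_atMost real_polynomial_function.intros(4)
        real_polynomial_function.intros(2) real_polynomial_function_power
        real_polynomial_function.intros(1) bounded_linear_ident)
  moreover have "P 0 = 0" by (simp add: P_def)
  moreover have "(P has_field_derivative p x) (at x)" for x
    unfolding P_def p
  proof (rule DERIV_sum)
    fix i
    have "((\<lambda>x. c i / real (Suc i) * x ^ Suc i) has_field_derivative
        c i / real (Suc i) * (real (Suc i) * x ^ i)) (at x)"
      by (rule DERIV_cmult) (use DERIV_pow[of "Suc i" x] in simp)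
    then show "((\<lambda>x. c i / real (Suc i) * x ^ Suc i) has_field_derivative c i * x ^ i) (at x)"
      by (simp del: of_nat_Suc)
  qed
  ultimately show thesis using that by blast
qed

lemma curl_has_derivative:
  assumes "(u has_derivative D) (at z)"
  shows "curl u z = snd (D (1, 0)) - fst (D (0, 1))"
proof -
  obtain x y where z: "z = (x, y)" by (cases z)
  have lin: "linear D" using assms has_derivative_linear by blast
  have "((\<lambda>t. (t, y)) has_derivative (\<lambda>h. (h, 0))) (at x)"
    by (intro has_derivative_Pair has_derivative_ident has_derivative_const)
  from has_derivative_compose[OF this, of u D] assms
  have 1: "((\<lambda>t. snd (u (t, y))) has_derivative (\<lambda>h. snd (D (h, 0)))) (at x)"
    unfolding z by (intro has_derivative_snd)
  have "(\<lambda>h. snd (D (h, 0))) = (*) (snd (D (1, 0)))"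
  proof
    fix h
    show "snd (D (h, 0)) = snd (D (1, 0)) * h"
      using linear_scale[OF lin, of h "(1, 0)"] by simp
  qed
  with 1 have "((\<lambda>t. snd (u (t, y))) has_field_derivative snd (D (1, 0))) (at x)"
    by (simp only: has_field_derivative_def)
  then have "deriv (\<lambda>t. snd (u (t, y))) x = snd (D (1, 0))"
    by (rule DERIV_imp_deriv)
  moreover
  have "((\<lambda>t. (x, t)) has_derivative (\<lambda>h. (0, h))) (at y)"
    by (intro has_derivative_Pair has_derivative_ident has_derivative_const)
  from has_derivative_compose[OF this, of u D] assms
  have 2: "((\<lambda>t. fst (u (x, t))) has_derivative (\<lambda>h. fst (D (0, h)))) (at y)"
    unfolding z by (intro has_derivative_fst)
  have "(\<lambda>h. fst (D (0, h))) = (*) (fst (D (0, 1)))"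
  proof
    fix h
    show "fst (D (0, h)) = fst (D (0, 1)) * h"
      using linear_scale[OF lin, of h "(0, 1)"] by simp
  qed
  with 2 have "((\<lambda>t. fst (u (x, t))) has_field_derivative fst (D (0, 1))) (at y)"
    by (simp only: has_field_derivative_def)
  then have "deriv (\<lambda>t. fst (u (x, t))) y = fst (D (0, 1))"
    by (rule DERIV_imp_deriv)
  ultimately show ?thesis
    by (simp add: curl_def z)
qed

lemma curl_scaleR:
  assumes "(f has_derivative D) (at z)" and v: "v differentiable (at z)"
  shows "curl (\<lambda>z. f z *\<^sub>R v z) z = f z * curl v z + (D (1, 0) * snd (v z) - D (0, 1) * fst (v z))"
proof -
  from v obtain E where E: "(v has_derivative E) (at z)"
    by (auto simp: differentiable_def)
  have "((\<lambda>z. f z *\<^sub>R v z) has_derivative (\<lambda>h. f z *\<^sub>R E h + D h *\<^sub>R v z)) (at z)"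
    by (rule has_derivative_scaleR[OF assms(1) E])
  from curl_has_derivative[OF this] show ?thesis
    unfolding curl_has_derivative[OF E] by (simp add: algebra_simps)
qed

lemma continuous_on_curl_polynomial_function:
  fixes u :: "real \<times> real \<Rightarrow> real \<times> real"
  assumes "polynomial_function u"
  shows "continuous_on UNIV (curl u)"
proof -
  have "curl u z = snd (frechet_derivative u (at z) (1, 0)) - fst (frechet_derivative u (at z) (0, 1))" for z
  proof (rule curl_has_derivative)
    show "(u has_derivative frechet_derivative u (at z)) (at z)"
      using differentiable_at_polynomial_function[OF assms, of z]
      by (simp only: frechet_derivative_works[symmetric])
  qed
  then have "curl u = (\<lambda>z. snd (frechet_derivative u (at z) (1, 0)) - fst (frechet_derivative u (at z) (0, 1)))"
    by (rule ext)
  then show ?thesis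
    by (simp only:) (intro continuous_on_diff continuous_on_fst continuous_on_snd
        continuous_on_polymonial_function polynomial_function_frechet_derivative assms)
qed


section \<open>Square integrable functions on a bounded set\<close>

lemma continuous_bounded_on_cbox:
  fixes f :: "'a::euclidean_space \<Rightarrow> 'b::euclidean_space"
  assumes "continuous_on UNIV f"
  shows "\<exists>B>0. \<forall>z\<in>cbox c d. norm (f z) \<le> B"
proof -
  have "bounded (f ` cbox c d)"
    using assms by (meson compact_cbox compact_continuous_image compact_imp_bounded
        continuous_on_subset subset_UNIV)
  then show ?thesis by (auto simp: bounded_pos)
qed

lemma square_integrable_continuous:
  fixes f :: "'a::euclidean_space \<Rightarrow> 'b::euclidean_space"
  assumes S: "S \<in> sets lebesgue" "S \<subseteq> cbox c d" and f: "continuous_on UNIV f"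
  shows "f \<in> square_integrable (lebesgue_on S)"
proof -
  obtain B where B: "B > 0" "\<And>z. z \<in> cbox c d \<Longrightarrow> norm (f z) \<le> B"
    using continuous_bounded_on_cbox[OF f] by blast
  have [measurable]: "f \<in> borel_measurable (lebesgue_on S)"
    using f S continuous_imp_measurable_on_sets_lebesgue continuous_on_subset by blast
  have "S \<in> lmeasurable"
    using S bounded_cbox bounded_set_imp_lmeasurable bounded_subset by blast
  then interpret finite_measure "lebesgue_on S"
    by (rule finite_measure_lebesgue_on)
  have "integrable (lebesgue_on S) (\<lambda>x. (norm (f x))\<^sup>2)"
    by (rule integrable_const_bound[of _ "B\<^sup>2"])
      (use S B(2) in \<open>auto intro!: AE_I2 power_mono simp: subset_iff\<close>)
  then show ?thesis by (simp add: square_integrable_def)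
qed

lemma square_integrable_imp_integrable:
  fixes f :: "'a \<Rightarrow> 'b::euclidean_space"
  assumes "finite_measure M" "f \<in> square_integrable M"
  shows "integrable M f"
proof -
  interpret finite_measure M by fact
  have f: "f \<in> borel_measurable M" "integrable M (\<lambda>x. (norm (f x))\<^sup>2)"
    using assms(2) by (auto simp: square_integrable_def)
  have le: "t \<le> 1 + t\<^sup>2" for t :: real
  proof -
    have "0 \<le> (t - 1 / 2)\<^sup>2 + 3 / 4" by (intro add_nonneg_nonneg) auto
    also have "\<dots> = 1 + t\<^sup>2 - t" by (simp add: power2_eq_square algebra_simps)
    finally show ?thesis by linarith
  qed
  show ?thesis
  proof (rule Bochner_Integration.integrable_bound)
    show "integrable M (\<lambda>x. 1 + (norm (f x))\<^sup>2)"
      using f by simp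
    show "AE x in M. norm (f x) \<le> norm (1 + (norm (f x))\<^sup>2)"
    proof (rule AE_I2)
      fix x
      have "norm (f x) \<le> 1 + (norm (f x))\<^sup>2" by (rule le)
      also have "\<dots> \<le> norm (1 + (norm (f x))\<^sup>2)" unfolding real_norm_def by (rule abs_ge_self)
      finally show "norm (f x) \<le> norm (1 + (norm (f x))\<^sup>2)" .
    qed
  qed (fact f)
qed

lemma integrable_mult_bounded:
  fixes f g :: "'a \<Rightarrow> real"
  assumes "integrable M f" "g \<in> borel_measurable M" "\<And>x. x \<in> space M \<Longrightarrow> \<bar>g x\<bar> \<le> B"
  shows "integrable M (\<lambda>x. f x * g x)"
proof (rule Bochner_Integration.integrable_bound[of _ "\<lambda>x. B * f x"])
  show "AE x in M. norm (f x * g x) \<le> norm (B * f x)"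
  proof (rule AE_I2)
    fix x assume "x \<in> space M"
    then have "\<bar>f x\<bar> * \<bar>g x\<bar> \<le> \<bar>f x\<bar> * \<bar>B\<bar>"
      using assms(3)[of x] by (intro mult_left_mono) auto
    then show "norm (f x * g x) \<le> norm (B * f x)" by (simp add: abs_mult mult.commute)
  qed
qed (use assms in auto)

text \<open>By the Stone-Weierstrass theorem the hypothesis extends from polynomials to continuous
  functions. The sign of \<open>f\<close> is almost everywhere a limit of continuous functions, which may be
  truncated to take values in the interval from -1 to 1, so dominated convergence makes the integral
  of the absolute value of \<open>f\<close> vanish.\<close>

lemma AE_zero_if_orthogonal_to_polynomials:
  fixes f :: "'a::euclidean_space \<Rightarrow> real"
  assumes S: "S \<in> sets lebesgue" "S \<subseteq> cbox c d" and f: "integrable (lebesgue_on S) f"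
    and orth: "\<And>p. real_polynomial_function p \<Longrightarrow> (\<integral>x. f x * p x \<partial>lebesgue_on S) = 0"
  shows "AE x in lebesgue_on S. f x = 0"
proof -
  let ?M = "lebesgue_on S"
  have [measurable]: "f \<in> borel_measurable ?M" using f by auto
  have cont_meas: "g \<in> borel_measurable ?M" if "continuous_on UNIV g" for g :: "'a \<Rightarrow> real"
    using that S continuous_imp_measurable_on_sets_lebesgue continuous_on_subset by blast
  have int_mult: "integrable ?M (\<lambda>x. f x * g x)" if g: "continuous_on UNIV g" for g
  proof -
    obtain B where "B > 0" "\<And>z. z \<in> cbox c d \<Longrightarrow> norm (g z) \<le> B"
      using continuous_bounded_on_cbox[OF g] by blast
    then show ?thesis
      using S by (intro integrable_mult_bounded[OF f cont_meas[OF g], of B]) auto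
  qed
  have orth_cont: "(\<integral>x. f x * g x \<partial>?M) = 0" if g: "continuous_on UNIV g" for g
  proof -
    define I where "I = (\<integral>x. \<bar>f x\<bar> \<partial>?M)"
    have "I \<ge> 0" unfolding I_def by simp
    have bound: "\<bar>\<integral>x. f x * g x \<partial>?M\<bar> \<le> e * I" if "e > 0" for e
    proof -
      obtain p where p: "real_polynomial_function p" "\<And>x. x \<in> cbox c d \<Longrightarrow> \<bar>g x - p x\<bar> < e"
        using Stone_Weierstrass_real_polynomial_function[OF compact_cbox _ \<open>e > 0\<close>, of c d g]
          continuous_on_subset[OF g] by blast
      have pc: "continuous_on UNIV p"
        using p(1) by (simp add: continuous_on_polymonial_function real_polynomial_function_eq)
      have "(\<integral>x. f x * g x \<partial>?M) = (\<integral>x. f x * g x - f x * p x \<partial>?M)"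
        using orth[OF p(1)] int_mult[OF g] int_mult[OF pc] by simp
      also have "\<bar>\<dots>\<bar> \<le> (\<integral>x. e * \<bar>f x\<bar> \<partial>?M)"
      proof (rule integral_abs_bound_integral)
        fix x assume "x \<in> space ?M"
        then have "\<bar>g x - p x\<bar> \<le> e" using p(2)[of x] S by auto
        then have "\<bar>f x\<bar> * \<bar>g x - p x\<bar> \<le> \<bar>f x\<bar> * e" by (rule mult_left_mono) simp
        then show "\<bar>f x * g x - f x * p x\<bar> \<le> e * \<bar>f x\<bar>"
          by (simp add: abs_mult[symmetric] right_diff_distrib mult.commute)
      qed (use f int_mult[OF g] int_mult[OF pc] in auto)
      finally show ?thesis by (simp add: I_def)
    qed
    have "\<bar>\<integral>x. f x * g x \<partial>?M\<bar> \<le> 0 + e" if "e > 0" for e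
    proof -
      have "e / (I + 1) * I \<le> e" using \<open>I \<ge> 0\<close> that by (simp add: field_simps)
      with bound[of "e / (I + 1)"] \<open>I \<ge> 0\<close> that show ?thesis by simp
    qed
    from field_le_epsilon[OF this] show ?thesis by simp
  qed
  have "(\<lambda>x. sgn (f x)) \<in> borel_measurable ?M" by measurable
  then have "(\<lambda>x. sgn (f x)) measurable_on S"
    using S by (simp add: measurable_on_iff_borel_measurable)
  then obtain N g where N: "negligible N" and g: "\<And>n::nat. continuous_on UNIV (g n)"
    and lim: "\<And>x. x \<notin> N \<Longrightarrow> (\<lambda>n. g n x) \<longlonglongrightarrow> (if x \<in> S then sgn (f x) else 0)"
    unfolding measurable_on_def by metis
  define h where "h = (\<lambda>n x. max (-1) (min 1 (g n x)))"
  have h: "continuous_on UNIV (h n)" for n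
    unfolding h_def by (intro continuous_intros g)
  have AE_N: "AE x in ?M. x \<notin> N"
  proof -
    have "AE x in lebesgue. x \<notin> N"
      using N by (simp add: AE_not_in negligible_iff_null_sets)
    then have "AE x in lebesgue. x \<in> S \<longrightarrow> x \<notin> N" by (rule AE_mp) simp
    then show ?thesis using S by (simp add: AE_restrict_space_iff)
  qed
  have "(\<lambda>n. \<integral>x. f x * h n x \<partial>?M) \<longlonglongrightarrow> (\<integral>x. \<bar>f x\<bar> \<partial>?M)"
  proof (rule integral_dominated_convergence[where w = "\<lambda>x. \<bar>f x\<bar>"])
    show "AE x in ?M. (\<lambda>n. f x * h n x) \<longlonglongrightarrow> \<bar>f x\<bar>"
      using AE_N AE_space
    proof eventually_elim
      case (elim x)
      then have "(\<lambda>n. g n x) \<longlonglongrightarrow> sgn (f x)" using lim[of x] S by simp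
      then have "(\<lambda>n. f x * h n x) \<longlonglongrightarrow> f x * max (-1) (min 1 (sgn (f x)))"
        unfolding h_def by (intro tendsto_intros)
      moreover have "f x * max (-1) (min 1 (sgn (f x))) = \<bar>f x\<bar>"
        by (auto simp: sgn_if)
      ultimately show ?case by simp
    qed
    have "\<bar>h n x\<bar> \<le> 1" for n x unfolding h_def by linarith
    then show "AE x in ?M. norm (f x * h n x) \<le> \<bar>f x\<bar>" for n
      by (intro AE_I2) (simp add: abs_mult mult_left_le)
  qed (use f h cont_meas in auto)
  then have "(\<lambda>_::nat. 0) \<longlonglongrightarrow> (\<integral>x. \<bar>f x\<bar> \<partial>?M)"
    using orth_cont[OF h] by simp
  then have "(\<integral>x. \<bar>f x\<bar> \<partial>?M) = 0"
    using LIMSEQ_const_iff by metis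
  then show ?thesis
    using integral_nonneg_eq_0_iff_AE[of ?M "\<lambda>x. \<bar>f x\<bar>"] f by simp
qed


section \<open>Small fields of almost unit curl force a trivial adjoint domain\<close>

text \<open>For \<open>U\<close> in the adjoint domain, represented by \<open>f\<close>, and a polynomial \<open>p\<close>, testing the adjoint
  relation on \<open>p v\<close> with a small field \<open>v\<close> bounds the integral of \<open>f p\<close> by a constant multiple of
  \<open>e\<close>. The constant depends on \<open>p\<close> and its gradient, but not on \<open>v\<close>.\<close>

lemma adjoint_domain_trivial_if_small_fields:
  fixes S :: "(real \<times> real) set"
  assumes S: "S \<in> sets lebesgue" "S \<subseteq> cbox c d"
    and curl_op: "is_curl_operator S D T"
    and smooth: "\<And>u. C_infinity u \<Longrightarrow> L2_class (lebesgue_on S) u \<in> D"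
    and fields: "\<And>e. e > 0 \<Longrightarrow> \<exists>v. polynomial_function v \<and>
      (\<forall>z\<in>S. norm (v z) \<le> e \<and> \<bar>curl v z - 1\<bar> \<le> e)"
  shows "adjoint_domain (lebesgue_on S) D T = {L2_zero (lebesgue_on S)}"
proof -
  let ?M = "lebesgue_on S"
  have fin: "finite_measure ?M"
    using S bounded_cbox bounded_set_imp_lmeasurable bounded_subset finite_measure_lebesgue_on by blast
  have D: "D \<subseteq> L2 ?M" and T: "\<And>X. X \<in> D \<Longrightarrow> T X \<in> L2 ?M"
    using curl_op by (auto simp: is_curl_operator_def densely_defined_operator_def)
  have T_poly: "L2_class ?M v \<in> D" "T (L2_class ?M v) = L2_class ?M (curl v)"
    if "polynomial_function v" for v
    using curl_op smooth C_infinity_polynomial_function[OF that] by (auto simp: is_curl_operator_def)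
  have L2_obtain: "\<exists>f. f \<in> square_integrable ?M \<and> X = L2_class ?M f" if "X \<in> L2 ?M"
    for X :: "(real \<times> real \<Rightarrow> 'b::euclidean_space) set"
    using that by (auto simp: L2_def L2_class_def elim: quotientE)
  have cont_sq: "f \<in> square_integrable ?M" if "continuous_on UNIV f"
    for f :: "real \<times> real \<Rightarrow> 'b::euclidean_space"
    using square_integrable_continuous[OF S that] .
  have inner_zero: "L2_inner ?M (L2_zero ?M) X = 0" if "X \<in> L2 ?M"
    for X :: "(real \<times> real \<Rightarrow> 'b::euclidean_space) set"
  proof -
    have z: "(\<lambda>_. 0 :: 'b) \<in> square_integrable ?M" by (simp add: square_integrable_def)
    from L2_obtain[OF that] obtain f where "f \<in> square_integrable ?M" "X = L2_class ?M f" by blast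
    then show ?thesis by (simp add: L2_zero_def L2_inner_class[OF z])
  qed
  have "L2_zero ?M \<in> adjoint_domain ?M D T"
  proof -
    have 1: "(L2_zero ?M :: (real \<times> real \<Rightarrow> real) set) \<in> L2 ?M"
      and 2: "(L2_zero ?M :: (real \<times> real \<Rightarrow> real \<times> real) set) \<in> L2 ?M"
      unfolding L2_zero_def by (intro L2_class_in_L2, simp add: square_integrable_def)+
    show ?thesis
      unfolding adjoint_domain_def
      using 1 by (auto intro!: bexI[OF _ 2] simp: inner_zero T D[THEN subsetD])
  qed
  moreover have "U = L2_zero ?M" if "U \<in> adjoint_domain ?M D T" for U
  proof -
    from that obtain W where U: "U \<in> L2 ?M" and W: "W \<in> L2 ?M"
      and adj: "\<And>V. V \<in> D \<Longrightarrow> L2_inner ?M W V = L2_inner ?M U (T V)"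
      by (auto simp: adjoint_domain_def)
    obtain f where f: "f \<in> square_integrable ?M" "U = L2_class ?M f" using L2_obtain[OF U] by blast
    obtain g where g: "g \<in> square_integrable ?M" "W = L2_class ?M g" using L2_obtain[OF W] by blast
    have fi: "integrable ?M f" and gi: "integrable ?M g"
      using square_integrable_imp_integrable[OF fin] f(1) g(1) by auto
    have adj_int: "(\<integral>x. g x \<bullet> v x \<partial>?M) = (\<integral>x. f x * curl v x \<partial>?M)" if v: "polynomial_function v" for v
    proof -
      have "v \<in> square_integrable ?M" "curl v \<in> square_integrable ?M"
        using v by (auto intro!: cont_sq continuous_on_polymonial_function continuous_on_curl_polynomial_function)
      with adj[OF T_poly(1)[OF v]] show ?thesis
        unfolding T_poly(2)[OF v] f(2) g(2)
        by (simp add: L2_inner_class f(1) g(1))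
    qed
    have mult_int: "integrable ?M (\<lambda>x. f x * p x)" if p: "continuous_on UNIV p" for p
    proof -
      obtain B where "B > 0" "\<And>z. z \<in> cbox c d \<Longrightarrow> norm (p z) \<le> B"
        using continuous_bounded_on_cbox[OF p] by blast
      then show ?thesis
        using S p by (intro integrable_mult_bounded[OF fi, of _ B])
          (auto intro: continuous_imp_measurable_on_sets_lebesgue continuous_on_subset)
    qed
    have "(\<integral>x. f x * p x \<partial>?M) = 0" if p: "real_polynomial_function p" for p
    proof -
      obtain E where E: "\<And>x. (p has_derivative E x) (at x)"
        "\<And>v. real_polynomial_function (\<lambda>x. E x v)"
        using real_polynomial_function_has_derivative[OF p] by blast
      have cont: "continuous_on UNIV p" "continuous_on UNIV (\<lambda>x. E x v)" for v
        using p E(2) by (auto simp: continuous_on_polymonial_function real_polynomial_function_eq)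
      obtain B0 where B0: "B0 > 0" "\<And>z. z \<in> cbox c d \<Longrightarrow> norm (p z) \<le> B0"
        using continuous_bounded_on_cbox[OF cont(1)] by blast
      obtain B1 where B1: "B1 > 0" "\<And>z. z \<in> cbox c d \<Longrightarrow> norm (E z (1, 0)) \<le> B1"
        using continuous_bounded_on_cbox[OF cont(2)] by blast
      obtain B2 where B2: "B2 > 0" "\<And>z. z \<in> cbox c d \<Longrightarrow> norm (E z (0, 1)) \<le> B2"
        using continuous_bounded_on_cbox[OF cont(2)] by blast
      define I where "I = (\<integral>x. norm (g x) \<partial>?M)"
      define J where "J = (\<integral>x. \<bar>f x\<bar> \<partial>?M)"
      \<comment> \<open>\<open>B0 * I\<close> accounts for the pairing of \<open>g\<close> with \<open>p v\<close>, the rest for that of \<open>f\<close> with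
        \<open>curl (p v) - p\<close>.\<close>
      define K where "K = B0 * I + (B0 + B1 + B2) * J"
      have "I \<ge> 0" "J \<ge> 0" by (simp_all add: I_def J_def)
      then have K: "K \<ge> 0" using B0 B1 B2 by (simp add: K_def)
      have bound: "\<bar>\<integral>x. f x * p x \<partial>?M\<bar> \<le> e * K" if e: "e > 0" for e
      proof -
        obtain v where v: "polynomial_function v"
          and small: "\<And>z. z \<in> S \<Longrightarrow> norm (v z) \<le> e" "\<And>z. z \<in> S \<Longrightarrow> \<bar>curl v z - 1\<bar> \<le> e"
          using fields[OF e] by blast
        let ?v = "\<lambda>z. p z *\<^sub>R v z"
        have pv: "polynomial_function ?v" by (rule polynomial_function_scaleR[OF p v])
        have pv_bound: "norm (?v x) \<le> B0 * e" if "x \<in> S" for x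
        proof -
          have "\<bar>p x\<bar> * norm (v x) \<le> B0 * e"
            using B0(1) B0(2)[of x] small(1)[OF that] S that by (intro mult_mono) auto
          then show ?thesis by simp
        qed
        have vi: "integrable ?M (\<lambda>x. g x \<bullet> ?v x)"
        proof (rule Bochner_Integration.integrable_bound[of _ "\<lambda>x. (B0 * e) *\<^sub>R norm (g x)"])
          have [measurable]: "?v \<in> borel_measurable ?M"
            using continuous_on_polymonial_function[OF pv] S
            by (auto intro: continuous_imp_measurable_on_sets_lebesgue continuous_on_subset)
          have [measurable]: "g \<in> borel_measurable ?M" using gi by auto
          show "(\<lambda>x. g x \<bullet> ?v x) \<in> borel_measurable ?M"
            by (intro borel_measurable_inner) measurable
          have "norm (g x \<bullet> ?v x) \<le> norm ((B0 * e) *\<^sub>R norm (g x))" if "x \<in> S" for x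
          proof -
            have "\<bar>g x \<bullet> ?v x\<bar> \<le> norm (g x) * norm (?v x)" by (rule Cauchy_Schwarz_ineq2)
            also have "\<dots> \<le> norm (g x) * (B0 * e)" by (rule mult_left_mono[OF pv_bound[OF that]]) simp
            finally show ?thesis using B0 e by (simp add: mult.commute)
          qed
          then show "AE x in ?M. norm (g x \<bullet> ?v x) \<le> norm ((B0 * e) *\<^sub>R norm (g x))"
            using S by (intro AE_I2) simp
        qed (use gi in auto)
        have ci: "integrable ?M (\<lambda>x. f x * curl ?v x)" "integrable ?M (\<lambda>x. f x * p x)"
          using mult_int continuous_on_curl_polynomial_function[OF pv] cont(1) by auto
        have "\<bar>\<integral>x. g x \<bullet> ?v x \<partial>?M\<bar> \<le> (\<integral>x. (B0 * e) * norm (g x) \<partial>?M)"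
        proof (rule integral_abs_bound_integral)
          fix x assume "x \<in> space ?M"
          then have "x \<in> S" using S by simp
          have "\<bar>g x \<bullet> ?v x\<bar> \<le> norm (g x) * norm (?v x)" by (rule Cauchy_Schwarz_ineq2)
          also have "\<dots> \<le> norm (g x) * (B0 * e)" by (rule mult_left_mono[OF pv_bound[OF \<open>x \<in> S\<close>]]) simp
          finally show "\<bar>g x \<bullet> ?v x\<bar> \<le> (B0 * e) * norm (g x)" by (simp add: mult.commute)
        qed (use vi gi in auto)
        then have 1: "\<bar>\<integral>x. f x * curl ?v x \<partial>?M\<bar> \<le> e * (B0 * I)"
          using adj_int[OF pv] by (simp add: I_def mult_ac)
        have "\<bar>\<integral>x. f x * curl ?v x - f x * p x \<partial>?M\<bar> \<le> (\<integral>x. (e * (B0 + B1 + B2)) * \<bar>f x\<bar> \<partial>?M)"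
        proof (rule integral_abs_bound_integral)
          fix x assume "x \<in> space ?M"
          then have x: "x \<in> S" "x \<in> cbox c d" using S by auto
          have comp: "\<bar>fst (v x)\<bar> \<le> e" "\<bar>snd (v x)\<bar> \<le> e"
            using small(1)[OF x(1)] norm_fst_le[of "fst (v x)" "snd (v x)"]
              norm_snd_le[of "snd (v x)" "fst (v x)"] by auto
          have "curl ?v x - p x = p x * (curl v x - 1) + (E x (1, 0) * snd (v x) - E x (0, 1) * fst (v x))"
            using curl_scaleR[OF E(1) differentiable_at_polynomial_function[OF v]]
            by (simp add: algebra_simps)
          also have "\<bar>\<dots>\<bar> \<le> \<bar>p x\<bar> * \<bar>curl v x - 1\<bar> + (\<bar>E x (1, 0)\<bar> * \<bar>snd (v x)\<bar> + \<bar>E x (0, 1)\<bar> * \<bar>fst (v x)\<bar>)"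
            unfolding abs_mult[symmetric] by linarith
          also have "\<dots> \<le> B0 * e + (B1 * e + B2 * e)"
            using B0 B1 B2 comp small(2) x e by (intro add_mono mult_mono) auto
          finally have "\<bar>curl ?v x - p x\<bar> \<le> e * (B0 + B1 + B2)" by (simp add: algebra_simps)
          then have "\<bar>f x\<bar> * \<bar>curl ?v x - p x\<bar> \<le> \<bar>f x\<bar> * (e * (B0 + B1 + B2))"
            by (rule mult_left_mono) simp
          then show "\<bar>f x * curl ?v x - f x * p x\<bar> \<le> (e * (B0 + B1 + B2)) * \<bar>f x\<bar>"
            by (simp add: abs_mult[symmetric] right_diff_distrib mult.commute)
        qed (use ci fi in auto)
        then have 2: "\<bar>(\<integral>x. f x * curl ?v x \<partial>?M) - (\<integral>x. f x * p x \<partial>?M)\<bar> \<le> e * ((B0 + B1 + B2) * J)"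
          using ci by (simp add: J_def mult_ac)
        have "e * K = e * (B0 * I) + e * ((B0 + B1 + B2) * J)"
          by (simp add: K_def distrib_left)
        with 1 2 show ?thesis by linarith
      qed
      have "\<bar>\<integral>x. f x * p x \<partial>?M\<bar> \<le> 0 + e" if "e > 0" for e
      proof -
        have "e / (K + 1) * K \<le> e" using K that by (simp add: field_simps)
        with bound[of "e / (K + 1)"] K that show ?thesis by simp
      qed
      from field_le_epsilon[OF this] show ?thesis by simp
    qed
    then have "AE x in ?M. f x = 0"
      by (rule AE_zero_if_orthogonal_to_polynomials[OF S fi])
    moreover have "(\<lambda>_. 0 :: real) \<in> square_integrable ?M" by (simp add: square_integrable_def)
    ultimately show ?thesis
      by (simp add: f(2) L2_zero_def L2_class_eq_iff[OF f(1)])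
  qed
  ultimately show ?thesis by blast
qed


section \<open>Unit steps concentrated near the centres of a grid\<close>

text \<open>The graph of the \<open>tent\<close> is a triangle of base \<open>2 q\<close>, height \<open>1 / q\<close> and hence area \<open>1\<close>. Writing it as
  a second difference of positive parts, rather than by cases, makes its antiderivative the same
  second difference of the squares.\<close>

definition tent :: "real \<Rightarrow> real \<Rightarrow> real" where
  "tent q t = (max 0 (t + q) - 2 * max 0 t + max 0 (t - q)) / q\<^sup>2"

definition unit_step :: "real \<Rightarrow> real \<Rightarrow> real" where
  "unit_step q t = ((max 0 (t + q))\<^sup>2 - 2 * (max 0 t)\<^sup>2 + (max 0 (t - q))\<^sup>2) / (2 * q\<^sup>2)"

lemma has_field_derivative_square_pos_part:
  "((\<lambda>t. (max 0 t)\<^sup>2) has_field_derivative 2 * max 0 x) (at x)" for x :: real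
proof -
  have "((\<lambda>t::real. if t \<in> {0..} then t\<^sup>2 else 0) has_vector_derivative
      (if x \<in> {0..} then 2 * x else 0)) (at x within UNIV)"
    by (rule has_vector_derivative_If_within_closures[where T = "{..<0}"])
      (auto intro!: derivative_eq_intros simp: has_real_derivative_iff_has_vector_derivative[symmetric])
  moreover have "(\<lambda>t::real. if t \<in> {0..} then t\<^sup>2 else 0) = (\<lambda>t. (max 0 t)\<^sup>2)"
    by (auto simp: max_def)
  ultimately show ?thesis
    by (simp add: has_real_derivative_iff_has_vector_derivative max_def split: if_splits)
qed

lemma has_field_derivative_unit_step:
  assumes "q > 0"
  shows "(unit_step q has_field_derivative tent q x) (at x)"
proof -
  have shift: "((\<lambda>t. (max 0 (t + b))\<^sup>2) has_field_derivative 2 * max 0 (x + b)) (at x)" for b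
    using has_field_derivative_square_pos_part[of "x + b"] unfolding DERIV_shift .
  have "((\<lambda>t. ((max 0 (t + q))\<^sup>2 - 2 * (max 0 t)\<^sup>2 + (max 0 (t - q))\<^sup>2) / (2 * q\<^sup>2)) has_field_derivative
      (2 * max 0 (x + q) - 2 * (2 * max 0 x) + 2 * max 0 (x - q)) / (2 * q\<^sup>2)) (at x)"
    using shift[of q] shift[of 0] shift[of "-q"]
    by (intro DERIV_cdivide DERIV_add DERIV_diff DERIV_cmult) auto
  moreover have "(2 * max 0 (x + q) - 2 * (2 * max 0 x) + 2 * max 0 (x - q)) / (2 * q\<^sup>2) = tent q x"
    using assms by (simp add: tent_def field_simps)
  ultimately show ?thesis by (simp add: unit_step_def[abs_def])
qed

lemma tent_bounds:
  assumes "q > 0"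
  shows "0 \<le> tent q t" "tent q t \<le> 1 / q" "q \<le> \<bar>t\<bar> \<Longrightarrow> tent q t = 0"
proof -
  have "0 \<le> max 0 (t + q) - 2 * max 0 t + max 0 (t - q)" using assms by linarith
  then show "0 \<le> tent q t" by (simp add: tent_def)
  have "max 0 (t + q) - 2 * max 0 t + max 0 (t - q) \<le> q" using assms by linarith
  then have "tent q t \<le> q / q\<^sup>2" unfolding tent_def by (rule divide_right_mono) simp
  then show "tent q t \<le> 1 / q" using assms by (simp add: power2_eq_square)
  show "tent q t = 0" if "q \<le> \<bar>t\<bar>"
    using assms that by (simp add: tent_def max_def abs_if split: if_splits)
qed

lemma unit_step_values:
  assumes "q > 0"
  shows "t \<le> - q \<Longrightarrow> unit_step q t = 0" "q \<le> t \<Longrightarrow> unit_step q t = 1"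
    "0 \<le> unit_step q t" "unit_step q t \<le> 1"
proof -
  show low: "unit_step q t = 0" if "t \<le> - q" for t
    using assms that by (simp add: unit_step_def max_def)
  show high: "unit_step q t = 1" if "q \<le> t" for t
  proof -
    have "(t + q)\<^sup>2 - 2 * t\<^sup>2 + (t - q)\<^sup>2 = 2 * q\<^sup>2" by (simp add: power2_eq_square algebra_simps)
    then show ?thesis using assms that by (simp add: unit_step_def max_def)
  qed
  have mono: "unit_step q s \<le> unit_step q t" if "s \<le> t" for s t
    by (rule DERIV_nonneg_imp_nondecreasing[OF that])
      (blast intro: has_field_derivative_unit_step[OF assms] tent_bounds(1)[OF assms])
  show "0 \<le> unit_step q t" using mono[of "min t (- q)" t] low[of "min t (- q)"] by simp
  show "unit_step q t \<le> 1" using mono[of t "max t q"] high[of "max t q"] by simp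
qed

text \<open>The staircase with steps of height \<open>s\<close> at the midpoints of the grid intervals agrees with the
  identity at the grid points: for \<open>x\<close> in the \<open>j\<close>-th interval all earlier steps are complete and no
  later one has begun, so both \<open>x\<close> and the staircase lie between \<open>j s\<close> and \<open>(j + 1) s\<close>.\<close>

lemma grid_steps_near_identity:
  assumes q: "q > 0" "2 * q \<le> s" and M: "real M * s = 1" and x: "0 \<le> x" "x \<le> 1"
  shows "\<bar>x - s * (\<Sum>k<M. unit_step q (x - (real k + 1 / 2) * s))\<bar> \<le> s"
proof -
  have s: "s > 0" using q by simp
  define j where "j = nat \<lfloor>x / s\<rfloor>"
  have "0 \<le> x / s" using x s by simp
  then have "real j \<le> x / s" "x / s < real j + 1" unfolding j_def by linarith+
  then have j: "real j * s \<le> x" "x < (real j + 1) * s" using s by (simp_all add: field_simps)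
  let ?t = "\<lambda>k. unit_step q (x - (real k + 1 / 2) * s)"
  have "real j * s \<le> real M * s" using j x M by linarith
  then have jM: "j \<le> M" using s by simp
  have "(if k < j then 1 else 0) \<le> ?t k" for k
  proof (cases "k < j")
    case True
    then have "(real k + 1) * s \<le> real j * s" using s by (intro mult_right_mono) auto
    then have "q \<le> x - (real k + 1 / 2) * s" using j q by (simp add: algebra_simps)
    then show ?thesis using unit_step_values(2)[OF q(1)] by simp
  qed (simp add: unit_step_values[OF q(1)])
  then have "(\<Sum>k<M. if k < j then 1 else 0) \<le> (\<Sum>k<M. ?t k)" by (rule sum_mono)
  moreover have "(\<Sum>k<M. if k < j then 1 else 0 :: real) = real j"
  proof -
    have "(\<Sum>k<M. if k < j then 1 else 0 :: real) = (\<Sum>k\<in>{..<M} \<inter> {..<j}. 1)"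
      by (subst sum.inter_restrict) auto
    also have "{..<M} \<inter> {..<j} = {..<j}" using jM by auto
    finally show ?thesis by simp
  qed
  ultimately have low: "real j \<le> (\<Sum>k<M. ?t k)" by simp
  have "?t k \<le> (if k < Suc j then 1 else 0)" for k
  proof (cases "k < Suc j")
    case False
    then have "(real j + 1) * s \<le> real k * s" using s by (intro mult_right_mono) auto
    then have "x - (real k + 1 / 2) * s \<le> - q" using j q by (simp add: algebra_simps)
    then show ?thesis using unit_step_values(1)[OF q(1)] False by simp
  qed (simp add: unit_step_values[OF q(1)])
  then have "(\<Sum>k<M. ?t k) \<le> (\<Sum>k<M. if k < Suc j then 1 else 0)" by (rule sum_mono)
  also have "\<dots> = (\<Sum>k\<in>{..<M} \<inter> {..<Suc j}. 1)"
    by (subst sum.inter_restrict) auto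
  also have "\<dots> \<le> real (Suc j)"
    using card_mono[of "{..<Suc j}" "{..<M} \<inter> {..<Suc j}"] by simp
  finally have up: "(\<Sum>k<M. ?t k) \<le> real j + 1" by simp
  have "s * real j \<le> s * (\<Sum>k<M. ?t k)" "s * (\<Sum>k<M. ?t k) \<le> s * (real j + 1)"
    using low up s by (auto intro: mult_left_mono)
  moreover have "s * real j \<le> x" "x \<le> s * real j + s" using j by (simp_all add: algebra_simps)
  moreover have "s * (real j + 1) = s * real j + s" by (simp add: algebra_simps)
  ultimately show ?thesis by linarith
qed

lemma grid_tents_bounds:
  fixes M :: nat
  assumes q: "q > 0" "2 * q \<le> s"
  defines "h \<equiv> \<lambda>x. s * (\<Sum>k<M. tent q (x - (real k + 1 / 2) * s))"
  shows "0 \<le> h x" "h x \<le> s / q"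
    "h x \<noteq> 0 \<Longrightarrow> \<exists>k. \<bar>x - (real k + 1 / 2) * s\<bar> < q"
proof -
  have s: "s > 0" using q by simp
  let ?t = "\<lambda>k. tent q (x - (real k + 1 / 2) * s)"
  show "0 \<le> h x"
    unfolding h_def using s tent_bounds(1)[OF q(1)] by (intro mult_nonneg_nonneg sum_nonneg) auto
  have far: "?t k = 0" if "\<not> \<bar>x - (real k + 1 / 2) * s\<bar> < q" for k
    using that tent_bounds(3)[OF q(1)] by simp
  show near: "\<exists>k. \<bar>x - (real k + 1 / 2) * s\<bar> < q" if "h x \<noteq> 0"
  proof (rule ccontr)
    assume "\<not> ?thesis"
    with far have "?t k = 0" for k by blast
    then have "h x = 0" unfolding h_def by (simp only: sum.neutral_const mult_zero_right)
    with that show False by simp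
  qed
  show "h x \<le> s / q"
  proof (cases "h x = 0")
    case True
    then show ?thesis using q s by simp
  next
    case False
    with near obtain k where k: "\<bar>x - (real k + 1 / 2) * s\<bar> < q" by blast
    \<comment> \<open>Distinct centres are \<open>s\<close> apart, so the tents have disjoint supports.\<close>
    have "?t l = 0" if "l \<noteq> k" for l
    proof (rule far)
      have "1 \<le> \<bar>real l - real k\<bar>" using that by linarith
      then have "s \<le> \<bar>real l - real k\<bar> * s" using s by simp
      also have "\<dots> = \<bar>(real l - real k) * s\<bar>" using s by (simp add: abs_mult)
      finally have "s \<le> \<bar>(real l + 1 / 2) * s - (real k + 1 / 2) * s\<bar>" by (simp add: algebra_simps)
      then show "\<not> \<bar>x - (real l + 1 / 2) * s\<bar> < q" using k q by linarith
    qed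
    then have "(\<Sum>l<M. ?t l) = (\<Sum>l<M. if l = k then ?t k else 0)"
      by (intro sum.cong) auto
    also have "\<dots> \<le> ?t k" using tent_bounds(1)[OF q(1)] by (simp add: sum.delta)
    also have "\<dots> \<le> 1 / q" by (rule tent_bounds(2)[OF q(1)])
    finally have "h x \<le> s * (1 / q)" unfolding h_def using s by (intro mult_left_mono) auto
    then show ?thesis by simp
  qed
qed

text \<open>Here \<open>p\<close> approximates the sum \<open>h\<close> of the tents scaled to area \<open>s\<close>, up to an error \<open>e\<close>, and
  \<open>P\<close> is the antiderivative of \<open>1 - p\<close> that vanishes at \<open>0\<close>. The identity minus the antiderivative
  \<open>H\<close> of \<open>h\<close> is bounded by \<open>s\<close>, and integration over the unit interval does not increase the error,
  so \<open>P\<close> inherits the bound \<open>s + e\<close>. A value of \<open>p\<close> that exceeds the error forces \<open>h\<close> to be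
  nonzero, so the point is near the midpoint of a grid interval.\<close>

lemma polynomial_profile:
  assumes q: "q > 0" "2 * q \<le> s" and M: "real M * s = 1" and e: "e > 0"
  obtains p P where "real_polynomial_function p" "real_polynomial_function P"
    "\<And>x. (P has_field_derivative 1 - p x) (at x)"
    "\<And>x. x \<in> {0..1} \<Longrightarrow> \<bar>P x\<bar> \<le> s + e"
    "\<And>x. x \<in> {0..1} \<Longrightarrow> \<bar>p x\<bar> \<le> s / q + e"
    "\<And>x. x \<in> {0..1} \<Longrightarrow> e < \<bar>p x\<bar> \<Longrightarrow> \<exists>k. \<bar>x - (real k + 1 / 2) * s\<bar> < q"
proof -
  have s: "s > 0" using q by simp
  define h where "h = (\<lambda>x. s * (\<Sum>k<M. tent q (x - (real k + 1 / 2) * s)))"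
  define H where "H = (\<lambda>x. s * (\<Sum>k<M. unit_step q (x - (real k + 1 / 2) * s)))"
  have H: "(H has_field_derivative h x) (at x)" for x
    unfolding H_def h_def
  proof (intro DERIV_cmult DERIV_sum)
    fix k
    show "((\<lambda>x. unit_step q (x - (real k + 1 / 2) * s)) has_field_derivative
        tent q (x - (real k + 1 / 2) * s)) (at x)"
      using has_field_derivative_unit_step[OF q(1), of "x + - ((real k + 1 / 2) * s)"]
      unfolding DERIV_shift by (simp only: add_uminus_conv_diff)
  qed
  have H0: "H 0 = 0"
  proof -
    have "unit_step q (0 - (real k + 1 / 2) * s) = 0" for k
    proof (rule unit_step_values(1)[OF q(1)])
      have "0 \<le> real k * s" using s by simp
      moreover have "(real k + 1 / 2) * s = real k * s + s / 2" by (simp add: algebra_simps)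
      ultimately show "0 - (real k + 1 / 2) * s \<le> - q" using q by linarith
    qed
    then show ?thesis by (simp add: H_def)
  qed
  have "continuous_on {0..1} h"
    unfolding h_def tent_def using q by (intro continuous_intros) auto
  then obtain p where p: "real_polynomial_function p" "\<And>x. x \<in> {0..1} \<Longrightarrow> \<bar>h x - p x\<bar> < e"
    using Stone_Weierstrass_real_polynomial_function[of "{0..1}" h e] e by auto
  have "real_polynomial_function (\<lambda>x. 1 - p x)" using p by auto
  then obtain P where P: "real_polynomial_function P" "P 0 = 0"
    "\<And>x. (P has_field_derivative 1 - p x) (at x)"
    using real_polynomial_function_antiderivative by blast
  have P_bound: "\<bar>P x\<bar> \<le> s + e" if x: "x \<in> {0..1}" for x
  proof -
    define R where "R = (\<lambda>x. P x - (x - H x))"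
    have R: "(R has_field_derivative h t - p t) (at t)" for t
      unfolding R_def by (rule derivative_eq_intros P(3) H refl | simp)+
    have "\<bar>R x - R 0\<bar> \<le> e * \<bar>x - 0\<bar>"
      by (rule field_differentiable_bound[of "{0..1}" R "\<lambda>t. h t - p t", unfolded real_norm_def])
        (use R p x in \<open>auto intro: has_field_derivative_at_within less_imp_le\<close>)
    also have "\<dots> \<le> e" using x e by (simp add: mult_left_le)
    finally have "\<bar>R x\<bar> \<le> e" using P H0 by (simp add: R_def)
    moreover have "\<bar>x - H x\<bar> \<le> s"
      unfolding H_def using grid_steps_near_identity[OF q M] x by simp
    ultimately show ?thesis by (simp add: R_def)
  qed
  have h: "0 \<le> h x" "h x \<le> s / q" "h x \<noteq> 0 \<Longrightarrow> \<exists>k. \<bar>x - (real k + 1 / 2) * s\<bar> < q" for x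
    unfolding h_def by (fact grid_tents_bounds[OF q])+
  show thesis
  proof (rule that[OF p(1) P(1,3) P_bound])
    fix x :: real assume x: "x \<in> {0..1}"
    then show "\<bar>p x\<bar> \<le> s / q + e" using p(2)[of x] h(1,2)[of x] by linarith
    assume "e < \<bar>p x\<bar>"
    then have "h x \<noteq> 0" using p(2)[OF x] by auto
    then show "\<exists>k. \<bar>x - (real k + 1 / 2) * s\<bar> < q" by (rule h(3))
  qed
qed


section \<open>The grid underlying the carpet\<close>

definition odd_reciprocals :: "(nat \<Rightarrow> real) \<Rightarrow> bool" where
  "odd_reciprocals a \<longleftrightarrow> (\<forall>i\<ge>1. \<exists>c::nat. c \<ge> 1 \<and> a i = 1 / real (2 * c + 1))"

definition side :: "(nat \<Rightarrow> real) \<Rightarrow> nat \<Rightarrow> real" where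
  "side a m = (\<Prod>k=1..m. a k)"

lemma side_0 [simp]: "side a 0 = 1"
  by (simp add: side_def)

lemma side_Suc: "side a (Suc m) = side a m * a (Suc m)"
  by (simp add: side_def mult.commute)

lemma side_pos: "odd_reciprocals a \<Longrightarrow> side a m > 0"
  unfolding side_def odd_reciprocals_def by (rule prod_pos) fastforce

lemma side_reciprocal:
  assumes "odd_reciprocals a"
  shows "\<exists>M::nat. real M * side a m = 1"
proof (induction m)
  case (Suc m)
  then obtain M where M: "real M * side a m = 1" by blast
  obtain c where c: "a (Suc m) = 1 / real (2 * c + 1)"
    using assms by (force simp: odd_reciprocals_def)
  have "real (M * (2 * c + 1)) * side a (Suc m) = (real M * side a m) * (real (2 * c + 1) * a (Suc m))"
    by (simp only: side_Suc of_nat_mult mult_ac)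
  also have "\<dots> = 1" using M c by (simp del: of_nat_Suc of_nat_add)
  finally show ?case by blast
qed (auto intro: exI[of _ 1])

lemma cbox_lower_corner_unique:
  fixes x y s :: real
  assumes "cbox (x, y) (x + s, y + s) = cbox (u, v) w" "s > 0"
  shows "x = u" "y = v"
proof -
  have "(x, y) \<in> cbox (x, y) (x + s, y + s)" using assms(2) by (simp add: cbox_Pair_eq)
  then have "(x, y) = (u, v)" using assms(1) unfolding eq_cbox by blast
  then show "x = u" "y = v" by simp_all
qed

lemma carpet_squares_on_grid:
  assumes a: "odd_reciprocals a" and "C \<in> carpet_squares a m"
  shows "\<exists>k l::nat. C = cbox (real k * side a m, real l * side a m)
    (real (k + 1) * side a m, real (l + 1) * side a m)"
  using assms(2)
proof (induction m arbitrary: C)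
  case 0
  then show ?case by (auto intro!: exI[of _ 0])
next
  case (Suc m)
  let ?s = "side a m" and ?r = "side a (Suc m)"
  obtain x y i j where C: "C = cbox (x + real i * ?r, y + real j * ?r) (x + real (i + 1) * ?r, y + real (j + 1) * ?r)"
    and mem: "cbox (x, y) (x + ?s, y + ?s) \<in> carpet_squares a m"
    using Suc.prems unfolding carpet_squares.simps Let_def side_def[symmetric] by blast
  from Suc.IH[OF mem] obtain k l :: nat where
    "cbox (x, y) (x + ?s, y + ?s) = cbox (real k * ?s, real l * ?s) (real (k + 1) * ?s, real (l + 1) * ?s)"
    by blast
  then have xy: "x = real k * ?s" "y = real l * ?s"
    using cbox_lower_corner_unique side_pos[OF a, of m] by blast+
  obtain c where c: "a (Suc m) = 1 / real (2 * c + 1)"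
    using a by (force simp: odd_reciprocals_def)
  have s: "?s = real (2 * c + 1) * ?r"
    by (simp add: side_Suc c del: of_nat_add of_nat_Suc)
  show ?case
    by (rule exI[of _ "k * (2 * c + 1) + i"], rule exI[of _ "l * (2 * c + 1) + j"])
      (simp add: C xy s algebra_simps)
qed

lemma carpet_subset_unit_square: "carpet a \<subseteq> cbox (0, 0) (1, 1)"
  unfolding carpet_def by (rule order_trans[OF INT_lower[of 0]]) auto

lemma carpet_measurable:
  assumes "odd_reciprocals a"
  shows "carpet a \<in> sets lebesgue"
proof -
  have "carpet_squares a m \<subseteq> (\<lambda>(k::nat, l::nat). cbox (real k * side a m, real l * side a m)
    (real (k + 1) * side a m, real (l + 1) * side a m)) ` UNIV" for m
    using carpet_squares_on_grid[OF assms] by fastforce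
  then have "countable (carpet_squares a m)" for m
    by (rule countable_subset) auto
  moreover have "C \<in> sets lebesgue" if "C \<in> carpet_squares a m" for C m
    using carpet_squares_on_grid[OF assms that] by auto
  ultimately have "\<Union> (carpet_squares a m) \<in> sets lebesgue" for m
    by (intro sets.countable_Union) auto
  then show ?thesis unfolding carpet_def by (intro sets.countable_INT'') auto
qed

lemma grid_cell_unique:
  assumes "real m * r \<le> x" "x \<le> (real m + 1) * r" "real n * r < x" "x < (real n + 1) * r" "r > 0"
  shows "m = n"
proof -
  have "real m * r < (real n + 1) * r" "real n * r < (real m + 1) * r" using assms by linarith+
  then have "real m < real n + 1" "real n < real m + 1" using assms(5) by simp_all
  then show ?thesis by linarith
qed

text \<open>Measured in units of the mesh of level \<open>m + 1\<close>, the hole column \<open>k\<close> is the open cell with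
  index \<open>k (2 c + 1) + c\<close>. A point in that open cell belongs to no other closed cell, so reducing the
  index modulo \<open>2 c + 1\<close> shows that the subsquare containing the point has horizontal index \<open>c\<close>.
  A point in both a hole column and a hole row would thus lie in a discarded central
  subsquare.\<close>

lemma carpet_avoids_holes:
  assumes a: "odd_reciprocals a" and xy: "(x, y) \<in> carpet a"
    and x: "\<bar>x - (real k + 1 / 2) * side a m\<bar> < side a (Suc m) / 2"
    and y: "\<bar>y - (real l + 1 / 2) * side a m\<bar> < side a (Suc m) / 2"
  shows False
proof -
  let ?s = "side a m" and ?r = "side a (Suc m)"
  obtain c where c: "a (Suc m) = 1 / real (2 * c + 1)"
    using a by (force simp: odd_reciprocals_def)
  have s: "?s = real (2 * c + 1) * ?r"
    by (simp add: side_Suc c del: of_nat_add of_nat_Suc)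
  have r: "?r > 0" by (rule side_pos[OF a])
  have "(x, y) \<in> \<Union> (carpet_squares a (Suc m))" using xy unfolding carpet_def by blast
  then obtain C where C: "(x, y) \<in> C" "C \<in> carpet_squares a (Suc m)" by blast
  then obtain x' y' i j where Ceq: "C = cbox (x' + real i * ?r, y' + real j * ?r) (x' + real (i + 1) * ?r, y' + real (j + 1) * ?r)"
    and mem: "cbox (x', y') (x' + ?s, y' + ?s) \<in> carpet_squares a m"
    and ij: "real i < 1 / a (Suc m)" "real j < 1 / a (Suc m)"
    and off: "\<not> (real (2 * i + 1) = 1 / a (Suc m) \<and> real (2 * j + 1) = 1 / a (Suc m))"
    unfolding carpet_squares.simps Let_def side_def[symmetric] by blast
  from carpet_squares_on_grid[OF a mem] obtain k' l' :: nat where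
    "cbox (x', y') (x' + ?s, y' + ?s) = cbox (real k' * ?s, real l' * ?s) (real (k' + 1) * ?s, real (l' + 1) * ?s)"
    by blast
  then have xy': "x' = real k' * ?s" "y' = real l' * ?s"
    using cbox_lower_corner_unique side_pos[OF a, of m] by blast+
  have ij': "i < 2 * c + 1" "j < 2 * c + 1"
    using ij unfolding c by (simp_all del: of_nat_add of_nat_Suc of_nat_mult)
  have centre: "i = c"
    if "x' + real i * ?r \<le> t" "t \<le> x' + real (i + 1) * ?r" "x' = real k' * ?s" "i < 2 * c + 1"
      "\<bar>t - (real k + 1 / 2) * ?s\<bar> < ?r / 2" for t x' and i k k' :: nat
  proof -
    have "real (k' * (2 * c + 1) + i) * ?r \<le> t" "t \<le> (real (k' * (2 * c + 1) + i) + 1) * ?r"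
      using that(1,2) unfolding that(3) s by (simp_all add: algebra_simps)
    moreover have "real (k * (2 * c + 1) + c) * ?r = (real k + 1 / 2) * ?s - ?r / 2"
      unfolding s by (simp add: algebra_simps)
    then have "real (k * (2 * c + 1) + c) * ?r < t" "t < (real (k * (2 * c + 1) + c) + 1) * ?r"
      using that(5) unfolding distrib_right by linarith+
    ultimately have "k' * (2 * c + 1) + i = k * (2 * c + 1) + c"
      using r by (rule grid_cell_unique)
    then have "(k' * (2 * c + 1) + i) mod (2 * c + 1) = (k * (2 * c + 1) + c) mod (2 * c + 1)"
      by simp
    then show "i = c" using that(4) by (simp only: mod_mult_self3 mod_less)
  qed
  have "i = c" "j = c"
    using C(1) centre[OF _ _ xy'(1) ij'(1) x] centre[OF _ _ xy'(2) ij'(2) y]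
    by (auto simp: Ceq cbox_Pair_eq)
  with off c show False by (simp del: of_nat_add of_nat_Suc)
qed


section \<open>Small fields of almost unit curl on the carpet\<close>

lemma curl_profile_field:
  assumes P: "\<And>x. (P has_field_derivative 1 - p x) (at x)" and p: "real_polynomial_function p"
  shows "curl (\<lambda>z. (- p (fst z) * P (snd z), P (fst z))) (x, y) = 1 - p x * p y"
proof -
  have "deriv P x = 1 - p x" using P by (rule DERIV_imp_deriv)
  moreover have "((\<lambda>t. - p x * P t) has_field_derivative - p x * (1 - p y)) (at y)"
    by (rule DERIV_cmult[OF P])
  then have "deriv (\<lambda>t. - p x * P t) y = - p x * (1 - p y)" by (rule DERIV_imp_deriv)
  ultimately show ?thesis by (simp add: curl_def algebra_simps)
qed

text \<open>The level is chosen such that \<open>s \<le> d b\<close>, and the polynomial approximation has error \<open>d b\<close>: this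
  makes \<open>P\<close> of size \<open>d b\<close>, which compensates the size \<open>1 / b\<close> of \<open>p\<close> in the product \<open>p x * P y\<close>, and
  it also controls \<open>p x * p y\<close>, of which at least one factor is at most \<open>d b\<close> on the carpet.\<close>

lemma carpet_small_fields:
  assumes a: "odd_reciprocals a"
    and lim: "(\<lambda>n. side a (n - 1) / a n) \<longlonglongrightarrow> 0"
    and e: "e > 0"
  shows "\<exists>v. polynomial_function v \<and> (\<forall>z\<in>carpet a. norm (v z) \<le> e \<and> \<bar>curl v z - 1\<bar> \<le> e)"
proof -
  \<comment> \<open>The components of the field turn out to be at most \<open>6 d\<close> and \<open>2 d\<close>; \<open>d \<le> 1\<close> makes the
    approximation error \<open>d b\<close> negligible against \<open>1 / b\<close>.\<close>
  define d where "d = min 1 (e / 8)"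
  have d: "d > 0" "d \<le> 1" "8 * d \<le> e" using e by (auto simp: d_def)
  have "eventually (\<lambda>n. side a (n - 1) / a n < d) sequentially"
    using lim d(1) by (rule order_tendstoD(2))
  then obtain n0 where "\<And>n. n \<ge> n0 \<Longrightarrow> side a (n - 1) / a n < d"
    by (auto simp: eventually_sequentially)
  from this[of "Suc n0"] have n: "side a n0 / a (Suc n0) < d" by simp
  define s where "s = side a n0"
  define b where "b = a (Suc n0)"
  obtain c where c: "c \<ge> 1" "b = 1 / real (2 * c + 1)"
    using a unfolding b_def by (force simp: odd_reciprocals_def)
  have b: "b > 0" "b \<le> 1" using c(1) unfolding c(2) by simp_all
  have s: "s > 0" unfolding s_def by (rule side_pos[OF a])
  have sb: "s \<le> d * b" using n b by (simp add: s_def b_def field_simps)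
  have r: "side a (Suc n0) = s * b" by (simp add: s_def b_def side_Suc)
  obtain M :: nat where M: "real M * s = 1"
    using side_reciprocal[OF a] unfolding s_def by blast
  have q: "s * b / 2 > 0" "2 * (s * b / 2) \<le> s" using s b by (auto simp: mult_left_le)
  have db: "d * b > 0" using d b by simp
  obtain p P where p: "real_polynomial_function p" and P: "real_polynomial_function P"
    and der: "\<And>x. (P has_field_derivative 1 - p x) (at x)"
    and Pb: "\<And>x. x \<in> {0..1} \<Longrightarrow> \<bar>P x\<bar> \<le> s + d * b"
    and pb: "\<And>x. x \<in> {0..1} \<Longrightarrow> \<bar>p x\<bar> \<le> s / (s * b / 2) + d * b"
    and supp: "\<And>x. x \<in> {0..1} \<Longrightarrow> d * b < \<bar>p x\<bar> \<Longrightarrow> \<exists>k. \<bar>x - (real k + 1 / 2) * s\<bar> < s * b / 2"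
    using polynomial_profile[OF q M db] by metis
  have Pb': "\<bar>P x\<bar> \<le> 2 * d * b" if "x \<in> {0..1}" for x
    using Pb[OF that] sb by simp
  have "d * b \<le> 1" using d b by (simp add: mult_le_one)
  also have "1 \<le> 1 / b" using b by simp
  finally have "d * b \<le> 1 / b" .
  then have pb': "\<bar>p x\<bar> \<le> 3 / b" if "x \<in> {0..1}" for x
    using pb[OF that] s by simp
  let ?v = "\<lambda>z. (- p (fst z) * P (snd z), P (fst z))"
  have lin: "real_polynomial_function (fst :: real \<times> real \<Rightarrow> real)"
    "real_polynomial_function (snd :: real \<times> real \<Rightarrow> real)"
    by (auto intro: real_polynomial_function.intros(1) bounded_linear_fst bounded_linear_snd)
  have comp: "real_polynomial_function (\<lambda>z::real \<times> real. f (fst z))"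
    "real_polynomial_function (\<lambda>z::real \<times> real. f (snd z))" if "real_polynomial_function f" for f :: "real \<Rightarrow> real"
    using real_polynomial_function_compose[of fst f] real_polynomial_function_compose[of snd f] that lin
    by (auto simp: real_polynomial_function_eq o_def)
  have "polynomial_function ?v"
    by (intro polynomial_function_Pair real_polynomial_function.intros(4) real_polynomial_function_minus comp p P)
  moreover have "norm (?v z) \<le> e \<and> \<bar>curl ?v z - 1\<bar> \<le> e" if z: "z \<in> carpet a" for z
  proof -
    obtain x y where xy: "z = (x, y)" by (cases z)
    have I: "x \<in> {0..1}" "y \<in> {0..1}"
      using z carpet_subset_unit_square[of a] by (auto simp: xy cbox_Pair_eq)
    have "\<bar>p x\<bar> * \<bar>P y\<bar> \<le> 3 / b * (2 * d * b)"
      using pb'[OF I(1)] Pb'[OF I(2)] b by (intro mult_mono) auto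
    also have "\<dots> = 6 * d" using b by simp
    finally have v1: "\<bar>p x * P y\<bar> \<le> 6 * d" by (simp add: abs_mult)
    have "2 * d * b \<le> 2 * d" using d b by simp
    then have v2: "\<bar>P x\<bar> \<le> 2 * d" using Pb'[OF I(1)] by linarith
    have "norm (?v z) \<le> \<bar>p x * P y\<bar> + \<bar>P x\<bar>"
      using norm_Pair_le[of "- p x * P y" "P x"] by (simp add: xy)
    then have norm: "norm (?v z) \<le> e" using v1 v2 d(3) by linarith
    have "\<bar>p x\<bar> \<le> d * b \<or> \<bar>p y\<bar> \<le> d * b"
    proof (rule ccontr)
      assume "\<not> ?thesis"
      then obtain k l :: nat where "\<bar>x - (real k + 1 / 2) * s\<bar> < s * b / 2" "\<bar>y - (real l + 1 / 2) * s\<bar> < s * b / 2"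
        using supp[OF I(1)] supp[OF I(2)] by fastforce
      with carpet_avoids_holes[OF a z[unfolded xy], where m = n0] show False
        unfolding r unfolding s_def[symmetric] by blast
    qed
    then have "\<bar>p x\<bar> * \<bar>p y\<bar> \<le> d * b * (3 / b)"
    proof
      assume "\<bar>p x\<bar> \<le> d * b"
      then show ?thesis using pb'[OF I(2)] db by (intro mult_mono) auto
    next
      assume "\<bar>p y\<bar> \<le> d * b"
      then have "\<bar>p y\<bar> * \<bar>p x\<bar> \<le> d * b * (3 / b)" using pb'[OF I(1)] db by (intro mult_mono) auto
      then show ?thesis by (simp add: mult.commute)
    qed
    also have "\<dots> = 3 * d" using b by simp
    finally have "\<bar>p x * p y\<bar> \<le> 3 * d" by (simp add: abs_mult)
    then have "\<bar>curl ?v z - 1\<bar> \<le> e"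
      unfolding xy curl_profile_field[OF der p] using d by simp
    with norm show ?thesis ..
  qed
  ultimately show ?thesis by blast
qed

section \<open>Triviality of the adjoint domain\<close>

theorem theorem2p1:
  fixes a :: "nat \<Rightarrow> real"
    and S :: "(real \<times> real) set"
    and Dom_curl :: "(real \<times> real \<Rightarrow> real \<times> real) set set"
    and curl_op :: "(real \<times> real \<Rightarrow> real \<times> real) set \<Rightarrow> (real \<times> real \<Rightarrow> real) set"
  assumes "\<And>i. i \<ge> 1 \<Longrightarrow> a i > 0"
    and "\<And>i. i \<ge> 1 \<Longrightarrow> \<exists>k::int. odd k \<and> k > 1 \<and> 1 / a i = of_int k"
    and "summable (\<lambda>i. (a (Suc i))\<^sup>2)"
    and "(\<lambda>n. (\<Prod>k=1..n-1. a k) / a n) \<longlonglongrightarrow> 0"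
    and "S = carpet a"
    and "is_curl_operator S Dom_curl curl_op"
    and "\<And>u. C_infinity u \<Longrightarrow> L2_class (lebesgue_on S) u \<in> Dom_curl"
  shows "adjoint_domain (lebesgue_on S) Dom_curl curl_op = {L2_zero (lebesgue_on S)}"
proof -
  have a: "odd_reciprocals a"
    unfolding odd_reciprocals_def
  proof (intro allI impI)
    fix i :: nat assume "1 \<le> i"
    with assms(2) obtain k :: int where k: "odd k" "k > 1" "1 / a i = of_int k" by blast
    then obtain j where j: "k = 2 * j + 1" by (elim oddE)
    then have "j \<ge> 1" using k by simp
    then have "real (2 * nat j + 1) = of_int k" using j by simp
    then have "a i = 1 / real (2 * nat j + 1)" using k(3) by (metis inverse_eq_divide inverse_inverse_eq)
    with \<open>j \<ge> 1\<close> show "\<exists>c::nat. c \<ge> 1 \<and> a i = 1 / real (2 * c + 1)"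
      by (intro exI[of _ "nat j"]) auto
  qed
  show ?thesis
  proof (rule adjoint_domain_trivial_if_small_fields[OF _ _ assms(6,7)])
    show "S \<in> sets lebesgue" using carpet_measurable[OF a] assms(5) by simp
    show "S \<subseteq> cbox (0, 0) (1, 1)" using carpet_subset_unit_square assms(5) by simp
    show "\<exists>v. polynomial_function v \<and> (\<forall>z\<in>S. norm (v z) \<le> e \<and> \<bar>curl v z - 1\<bar> \<le> e)" if "e > 0" for e
      using carpet_small_fields[OF a _ that] assms(4,5) by (simp add: side_def)
  qed
qed

end
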